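(* Let $\mathscr{E}=\{E_1|H_1,\ldots,E_n|H_n\}$ be a family of $n$ conditional events with $E_1,\ldots,E_n,H_1,\ldots,H_n$ logically independent. Let $\mathcal{M}=(x_S:\emptyset\neq S\subseteq\{1,\ldots,n\})$ be a prevision assessment on the family $\mathscr{F}=\{\mathscr{C}_S:\emptyset\neq S\subseteq\{1,\ldots,n\}\}$, where $\mathscr{C}_S=\bigwedge_{i\in S}(E_i|H_i)$ and $x_S=\mathbb{P}(\mathscr{C}_S)$. Then $\mathcal{M}$ is coherent if and only if $\mathcal{M}$ belongs to the convex hull $\mathcal{I}_{\mathcal{B}}$ (in $\mathbb{R}^{2^n-1}$) of the $2^n$ binary points $Q_1,\ldots,Q_{2^n}$, i.e. the values taken by the random vector $(\mathscr{C}_S:\emptyset\neq S\subseteq\{1,\ldots,n\})$ on the $2^n$ constituents obtained by expanding $\bigwedge_{i=1}^n(E_iH_i\vee\overline{E}_iH_i)$.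
   Context: Events. Events are elements of a Boolean algebra with top $\Omega$ (sure event) and bottom $\emptyset$ (impossible event); one may take subsets of a set $\Omega$. An event is identified with its $0/1$ indicator; $EF$ or $E\wedge F$ is conjunction, $E\vee F$ disjunction, $\overline{E}$ negation. Events $A_1,\ldots,A_m$ are logically independent if all $2^m$ conjunctions $A_1^*\cdots A_m^*$ with $A_i^*\in\{A_i,\overline{A}_i\}$ are $\neq\emptyset$. Conditional random quantities. Given an event $H\neq\emptyset$, a random quantity $X$ (a real-valued function on $\Omega$ with finitely many values on $H$) and an assessed real number $\mu=\mathbb{P}(X|H)$ (the conditional prevision), the conditional random quantity $X|H$ is $XH+\mu\overline{H}$ (value $X$ if $H$ is true, $\mu$ if $H$ is false). For a conditional event $E|H$ with $P(E|H)=x$, its indicator (same symbol) is $E|H=EH+x\overline{H}$; it is true, false or void when $EH$, $\overline{E}H$ or $\overline{H}$ is true, respectively. Coherence. A prevision assessment on a family of conditional random quantities is coherent if for every finite subfamily $X_1|H_1,\ldots,X_m|H_m$ with assessed previsions $\mu_1,\ldots,\mu_m$ and all real $s_1,\ldots,s_m$, the random gain $G=\sum_{i=1}^m s_iH_i(X_i-\mu_i)$, restricted to $H_1\vee\cdots\vee H_m$, satisfies $\min G\le 0\le\max G$. Conjunction. For a finite family $(E_i|H_i)_{i\in T}$ of conditional events, the conjunctions $\mathscr{C}_S=\bigwedge_{i\in S}(E_i|H_i)$, $\emptyset\ne S\subseteq T$, with assessed previsions $x_S=\mathbb{P}(\mathscr{C}_S)$, are defined recursively on $|S|$ by \[ \mathscr{C}_S=\Big[\bigwedge_{i\in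 S}E_iH_i+\sum_{\emptyset\neq R\subsetneq S}x_R\Big(\bigwedge_{i\in R}\overline{H}_i\Big)\wedge\Big(\bigwedge_{i\in S\setminus R}E_iH_i\Big)\Big]\Big|\Big(\bigvee_{i\in S}H_i\Big), \] i.e. $\mathscr{C}_S$ has value $1$ if all $E_iH_i$ ($i\in S$) are true; $0$ if some $\overline{E}_iH_i$ is true; $x_R$ if exactly the conditional events with index in $R$ are void and the others are true ($\emptyset\ne R\subsetneq S$); $x_S$ if all $H_i$, $i\in S$, are false. For $S=\{i\}$, $\mathscr{C}_S=E_i|H_i$. Binary points. On the constituent in which $E_iH_i$ is true for $i\in A$ and $\overline{E}_iH_i$ is true for $i\notin A$ ($A\subseteq\{1,\ldots,n\}$), the random vector $(\mathscr{C}_S)_S$ takes the value $Q_A=(q_{A,S}:\emptyset\ne S\subseteq\{1,\ldots,n\})$ with $q_{A,S}=1$ if $S\subseteq A$ and $q_{A,S}=0$ otherwise; $\mathcal{B}=\{Q_1,\ldots,Q_{2^n}\}=\{Q_A:A\subseteq\{1,\ldots,n\}\}$. *)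

theory Defs
  imports "HOL-Analysis.Analysis"
begin

text \<open>
  Events are subsets of the type \<open>'w\<close>, so the sure event is \<open>UNIV\<close>.  The \<open>n\<close> conditional events
  are indexed by a finite type \<open>'n\<close>, so \<open>n = CARD('n)\<close>, and the nonempty subsets of the index set
  form the type \<open>'n nonempty\<close>, so that \<open>real ^ 'n nonempty\<close> is Euclidean space of dimension
  \<open>2 ^ n - 1\<close>.
\<close>

typedef 'n nonempty = "{S :: 'n set. S \<noteq> {}}"
  morphisms elems Abs_nonempty
  by auto

instance nonempty :: (finite) finite
proof
  show "finite (UNIV :: 'a nonempty set)"
    by (rule finite_imageD[of elems])
      (auto simp: inj_on_def elems_inject intro: finite_subset[OF subset_UNIV])
qed

lemma elems_nonempty [simp]: "elems S \<noteq> {}"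
  using elems[of S] by simp

definition logically_independent :: "('k \<Rightarrow> 'w set) \<Rightarrow> bool" where
  "logically_independent A \<longleftrightarrow> (\<forall>P. (\<Inter>k. if k \<in> P then A k else - A k) \<noteq> {})"

lemma logically_independentE:
  assumes "logically_independent A"
  obtains w where "\<And>k. w \<in> A k \<longleftrightarrow> k \<in> P"
proof -
  have "(\<Inter>k. if k \<in> P then A k else - A k) \<noteq> {}"
    using assms by (simp add: logically_independent_def)
  then obtain w where w: "w \<in> (\<Inter>k. if k \<in> P then A k else - A k)"
    by blast
  have "w \<in> A k \<longleftrightarrow> k \<in> P" for k
    using INT_D[OF w, of k] by (cases "k \<in> P") auto
  then show thesis
    by (rule that)
qed

text \<open>The conditional random quantity \<open>X|H\<close> with assessed prevision \<open>\<mu>\<close>.\<close>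

definition cond_rq :: "('w \<Rightarrow> real) \<Rightarrow> 'w set \<Rightarrow> real \<Rightarrow> 'w \<Rightarrow> real" where
  "cond_rq X H \<mu> w = X w * indicator H w + \<mu> * indicator (- H) w"

definition gain :: "'k set \<Rightarrow> ('k \<Rightarrow> real) \<Rightarrow> ('k \<Rightarrow> 'w \<Rightarrow> real) \<Rightarrow> ('k \<Rightarrow> 'w set) \<Rightarrow> ('k \<Rightarrow> real)
    \<Rightarrow> 'w \<Rightarrow> real" where
  "gain J s X H \<mu> w = (\<Sum>k\<in>J. s k * indicator (H k) w * (X k w - \<mu> k))"

text \<open>
  Coherence of the prevision assessment \<open>\<mu>\<close> on the family of conditional random quantities
  \<open>X k | H k\<close>.  It is to be used only when each \<open>H k\<close> is nonempty and each \<open>X k\<close> has finitely many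
  values on \<open>H k\<close>; then the \<open>Min\<close> and \<open>Max\<close> below range over nonempty finite sets
  (lemma \<open>finite_gain_image\<close>).  For conjunctions of conditional events, see
  \<open>conj_event_nonempty\<close> and \<open>finite_conj_rq_image\<close>.
\<close>

definition coherent :: "('k \<Rightarrow> 'w \<Rightarrow> real) \<Rightarrow> ('k \<Rightarrow> 'w set) \<Rightarrow> ('k \<Rightarrow> real) \<Rightarrow> bool" where
  "coherent X H \<mu> \<longleftrightarrow>
     (\<forall>J s. finite J \<longrightarrow> J \<noteq> {} \<longrightarrow>
        Min (gain J s X H \<mu> ` (\<Union>k\<in>J. H k)) \<le> 0 \<and>
        0 \<le> Max (gain J s X H \<mu> ` (\<Union>k\<in>J. H k)))"

lemma finite_gain_image:
  assumes "finite J" and "\<And>k. k \<in> J \<Longrightarrow> finite (X k ` H k)"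
  shows "finite (gain J s X H \<mu> ` U)"
  using assms
proof (induction J rule: finite_induct)
  case empty
  have "gain {} s X H \<mu> ` U \<subseteq> {0}"
    by (auto simp: gain_def)
  then show ?case
    by (rule finite_subset) simp
next
  case (insert k J)
  let ?A = "insert 0 ((\<lambda>v. s k * (v - \<mu> k)) ` (X k ` H k))"
  let ?B = "gain J s X H \<mu> ` U"
  have "gain (insert k J) s X H \<mu> w \<in> (\<lambda>(a, b). a + b) ` (?A \<times> ?B)" if "w \<in> U" for w
  proof -
    have "s k * indicator (H k) w * (X k w - \<mu> k) \<in> ?A"
      by (cases "w \<in> H k") auto
    moreover have "gain J s X H \<mu> w \<in> ?B"
      using that by blast
    moreover have "gain (insert k J) s X H \<mu> w =
        s k * indicator (H k) w * (X k w - \<mu> k) + gain J s X H \<mu> w"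
      using insert.hyps by (simp add: gain_def)
    ultimately show ?thesis
      by (intro image_eqI[OF _ SigmaI]) (simp_all only: prod.case)
  qed
  then have "gain (insert k J) s X H \<mu> ` U \<subseteq> (\<lambda>(a, b). a + b) ` (?A \<times> ?B)"
    by blast
  moreover have "finite ((\<lambda>(a, b). a + b) ` (?A \<times> ?B))"
  proof (rule finite_imageI[OF finite_cartesian_product])
    show "finite ?A"
      using insert.prems by simp
    show "finite ?B"
      using insert by simp
  qed
  ultimately show ?case
    by (rule finite_subset)
qed

text \<open>
  The conjunction \<open>\<C>\<^sub>S\<close> is \<open>conj_rq E H x S | conj_event H S\<close> with prevision \<open>x $ S\<close>.  The
  recursion on the cardinality of \<open>S\<close> enters only through the previsions \<open>x $ R\<close> of the smaller
  conjunctions, all of which are components of the given vector \<open>x\<close>.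
\<close>

definition conj_rq :: "('n::finite \<Rightarrow> 'w set) \<Rightarrow> ('n \<Rightarrow> 'w set) \<Rightarrow> real ^ 'n nonempty
    \<Rightarrow> 'n nonempty \<Rightarrow> 'w \<Rightarrow> real" where
  "conj_rq E H x S w =
     indicator (\<Inter>i\<in>elems S. E i \<inter> H i) w +
     (\<Sum>R | elems R \<subset> elems S.
        x $ R * indicator ((\<Inter>i\<in>elems R. - H i) \<inter> (\<Inter>i\<in>elems S - elems R. E i \<inter> H i)) w)"

definition conj_event :: "('n \<Rightarrow> 'w set) \<Rightarrow> 'n nonempty \<Rightarrow> 'w set" where
  "conj_event H S = (\<Union>i\<in>elems S. H i)"

definition conjunction :: "('n::finite \<Rightarrow> 'w set) \<Rightarrow> ('n \<Rightarrow> 'w set) \<Rightarrow> real ^ 'n nonempty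
    \<Rightarrow> 'n nonempty \<Rightarrow> 'w \<Rightarrow> real" where
  "conjunction E H x S = cond_rq (conj_rq E H x S) (conj_event H S) (x $ S)"

definition coherent_conjunctions :: "('n::finite \<Rightarrow> 'w set) \<Rightarrow> ('n \<Rightarrow> 'w set) \<Rightarrow>
    real ^ 'n nonempty \<Rightarrow> bool" where
  "coherent_conjunctions E H x \<longleftrightarrow> coherent (conj_rq E H x) (conj_event H) (\<lambda>S. x $ S)"

definition binary_point :: "'n::finite set \<Rightarrow> real ^ 'n nonempty" where
  "binary_point A = (\<chi> S. if elems S \<subseteq> A then 1 else 0)"

definition constituent :: "('n \<Rightarrow> 'w set) \<Rightarrow> ('n \<Rightarrow> 'w set) \<Rightarrow> 'n set \<Rightarrow> 'w set" where
  "constituent E H A = (\<Inter>i\<in>A. E i \<inter> H i) \<inter> (\<Inter>i\<in>- A. - E i \<inter> H i)"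

lemma finite_conj_rq_image:
  fixes E H :: "'n::finite \<Rightarrow> 'w set"
  shows "finite (conj_rq E H x S ` U)"
proof -
  let ?p = "\<lambda>w. ({i. w \<in> E i}, {i. w \<in> H i})"
  let ?f = "\<lambda>p. conj_rq (\<lambda>i. {u. i \<in> fst u}) (\<lambda>i. {u. i \<in> snd u}) x S p"
  have "conj_rq E H x S w = ?f (?p w)" for w
    unfolding conj_rq_def by (simp add: indicator_def)
  then have "conj_rq E H x S ` U \<subseteq> range ?f"
    by blast
  then show ?thesis
    by (rule finite_subset) simp
qed

lemma conj_event_nonempty:
  assumes "logically_independent (case_sum E H)"
  shows "conj_event H S \<noteq> {}"
proof -
  obtain w where w: "w \<in> case_sum E H k \<longleftrightarrow> k \<in> UNIV" for k
    by (rule logically_independentE[OF assms, where P = UNIV]) (rule that)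
  have "w \<in> H i" for i
    using w[of "Inr i"] by simp
  moreover obtain i where "i \<in> elems S"
    using elems_nonempty[of S] by blast
  ultimately show ?thesis
    unfolding conj_event_def by blast
qed

lemma conjunction_true:
  fixes E H :: "'n::finite \<Rightarrow> 'w set"
  assumes "\<And>i. i \<in> elems S \<Longrightarrow> w \<in> E i \<inter> H i"
  shows "conjunction E H x S w = 1"
proof -
  have "x $ R * indicator ((\<Inter>i\<in>elems R. - H i) \<inter> (\<Inter>i\<in>elems S - elems R. E i \<inter> H i)) w = 0"
    if R: "elems R \<subset> elems S" for R
  proof -
    obtain i where "i \<in> elems R" "i \<in> elems S"
      using elems_nonempty[of R] R by blast
    then show ?thesis
      using assms[of i] by (auto simp: indicator_def)
  qed
  then have "(\<Sum>R | elems R \<subset> elems S.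
      x $ R * indicator ((\<Inter>i\<in>elems R. - H i) \<inter> (\<Inter>i\<in>elems S - elems R. E i \<inter> H i)) w) = 0"
    by (intro sum.neutral) blast
  moreover have "w \<in> (\<Inter>i\<in>elems S. E i \<inter> H i)"
    using assms by blast
  ultimately have "conj_rq E H x S w = 1"
    by (simp only: conj_rq_def indicator_simps add_0_right add_0_left not_False_eq_True)
  moreover have "w \<in> conj_event H S"
    using assms elems_nonempty[of S] unfolding conj_event_def by blast
  ultimately show ?thesis
    by (simp add: conjunction_def cond_rq_def)
qed

lemma conjunction_false:
  fixes E H :: "'n::finite \<Rightarrow> 'w set"
  assumes "i \<in> elems S" and "w \<in> - E i \<inter> H i"
  shows "conjunction E H x S w = 0"
proof -
  have "x $ R * indicator ((\<Inter>i\<in>elems R. - H i) \<inter> (\<Inter>i\<in>elems S - elems R. E i \<inter> H i)) w = 0" for R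
    using assms by (auto simp: indicator_def)
  then have "(\<Sum>R | elems R \<subset> elems S.
      x $ R * indicator ((\<Inter>i\<in>elems R. - H i) \<inter> (\<Inter>i\<in>elems S - elems R. E i \<inter> H i)) w) = 0"
    by (intro sum.neutral) blast
  moreover have "w \<notin> (\<Inter>i\<in>elems S. E i \<inter> H i)"
    using assms by blast
  ultimately have "conj_rq E H x S w = 0"
    by (simp only: conj_rq_def indicator_simps add_0_right add_0_left not_False_eq_True)
  moreover have "w \<in> conj_event H S"
    using assms unfolding conj_event_def by blast
  ultimately show ?thesis
    by (simp add: conjunction_def cond_rq_def)
qed

lemma conjunction_partly_void:
  fixes E H :: "'n::finite \<Rightarrow> 'w set"
  assumes R: "elems R \<subset> elems S"
    and void: "\<And>i. i \<in> elems R \<Longrightarrow> w \<notin> H i"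
    and true: "\<And>i. i \<in> elems S - elems R \<Longrightarrow> w \<in> E i \<inter> H i"
  shows "conjunction E H x S w = x $ R"
proof -
  have eq: "R' = R" if "elems R' \<subset> elems S"
    "w \<in> (\<Inter>i\<in>elems R'. - H i) \<inter> (\<Inter>i\<in>elems S - elems R'. E i \<inter> H i)" for R'
  proof -
    have "elems R' = elems R"
      using that R void true by blast
    then show ?thesis
      by (simp add: elems_inject)
  qed
  have in_R: "w \<in> (\<Inter>i\<in>elems R. - H i) \<inter> (\<Inter>i\<in>elems S - elems R. E i \<inter> H i)"
    using void true by blast
  have "(\<Sum>R' | elems R' \<subset> elems S.
      x $ R' * indicator ((\<Inter>i\<in>elems R'. - H i) \<inter> (\<Inter>i\<in>elems S - elems R'. E i \<inter> H i)) w) =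
    (\<Sum>R' | elems R' \<subset> elems S. if R' = R then x $ R else 0)"
  proof (rule sum.cong)
    fix R' assume "R' \<in> {R'. elems R' \<subset> elems S}"
    then show "x $ R' * indicator ((\<Inter>i\<in>elems R'. - H i) \<inter> (\<Inter>i\<in>elems S - elems R'. E i \<inter> H i)) w =
        (if R' = R then x $ R else 0)"
      using eq[of R'] in_R by (cases "R' = R") (auto simp only: indicator_def mem_Collect_eq, simp_all)
  qed simp
  also have "\<dots> = x $ R"
    using R by simp
  finally have sum: "(\<Sum>R' | elems R' \<subset> elems S.
      x $ R' * indicator ((\<Inter>i\<in>elems R'. - H i) \<inter> (\<Inter>i\<in>elems S - elems R'. E i \<inter> H i)) w) =
    x $ R" .
  have "w \<notin> (\<Inter>i\<in>elems S. E i \<inter> H i)"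
    using R void elems_nonempty[of R] by blast
  with sum have "conj_rq E H x S w = x $ R"
    by (simp only: conj_rq_def indicator_simps add_0_right add_0_left not_False_eq_True)
  moreover have "w \<in> conj_event H S"
    using R true unfolding conj_event_def by blast
  ultimately show ?thesis
    by (simp add: conjunction_def cond_rq_def)
qed

lemma conjunction_void:
  fixes E H :: "'n::finite \<Rightarrow> 'w set"
  assumes "\<And>i. i \<in> elems S \<Longrightarrow> w \<notin> H i"
  shows "conjunction E H x S w = x $ S"
proof -
  have "w \<notin> conj_event H S"
    using assms unfolding conj_event_def by blast
  then show ?thesis
    by (simp add: conjunction_def cond_rq_def)
qed

lemma conjunction_singleton:
  fixes E H :: "'n::finite \<Rightarrow> 'w set"
  assumes S: "elems S = {i}"
  shows "conjunction E H x S = cond_rq (indicator (E i)) (H i) (x $ S)"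
proof
  fix w
  consider "w \<in> E i \<inter> H i" | "w \<in> - E i \<inter> H i" | "w \<notin> H i"
    by blast
  then show "conjunction E H x S w = cond_rq (indicator (E i)) (H i) (x $ S) w"
  proof cases
    case 1
    then have "conjunction E H x S w = 1"
      using S by (intro conjunction_true) auto
    with 1 show ?thesis
      by (simp add: cond_rq_def)
  next
    case 2
    then have "conjunction E H x S w = 0"
      using S by (intro conjunction_false[of i]) auto
    with 2 show ?thesis
      by (simp add: cond_rq_def)
  next
    case 3
    then have "conjunction E H x S w = x $ S"
      using S by (intro conjunction_void) auto
    with 3 show ?thesis
      by (simp add: cond_rq_def)
  qed
qed

text \<open>
  The binary points are exactly the values of the random vector of all conjunctions on the event
  that no conditional event is void; see \<open>range_binary_point\<close>.
\<close>

lemma conjunction_on_constituent: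
  fixes E H :: "'n::finite \<Rightarrow> 'w set"
  assumes w: "w \<in> constituent E H A"
  shows "(\<chi> S. conjunction E H x S w) = binary_point A"
proof -
  have "conjunction E H x S w = (if elems S \<subseteq> A then 1 else 0)" for S
  proof (cases "elems S \<subseteq> A")
    case True
    then have "conjunction E H x S w = 1"
      using w by (intro conjunction_true) (auto simp: constituent_def)
    with True show ?thesis by simp
  next
    case False
    then obtain i where i: "i \<in> elems S" "i \<notin> A" by blast
    then have "w \<in> - E i \<inter> H i"
      using w by (auto simp: constituent_def)
    with i False show ?thesis
      by (simp add: conjunction_false)
  qed
  then show ?thesis
    by (simp add: binary_point_def)
qed

lemma constituent_nonempty:
  fixes E H :: "'n::finite \<Rightarrow> 'w set"
  assumes "logically_independent (case_sum E H)"
  shows "constituent E H A \<noteq> {}"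
proof -
  let ?P = "Inl ` A \<union> range Inr"
  obtain w where w: "w \<in> case_sum E H k \<longleftrightarrow> k \<in> ?P" for k
    by (rule logically_independentE[OF assms, where P = ?P]) (rule that)
  have "w \<in> H i" for i
    using w[of "Inr i"] by simp
  moreover have "w \<in> E i \<longleftrightarrow> i \<in> A" for i
    using w[of "Inl i"] by auto
  ultimately have "w \<in> constituent E H A"
    by (simp add: constituent_def)
  then show ?thesis
    by auto
qed

lemma range_binary_point:
  fixes E H :: "'n::finite \<Rightarrow> 'w set"
  assumes "logically_independent (case_sum E H)"
  shows "range binary_point =
    (\<lambda>w. \<chi> S. conjunction E H x S w) ` (\<Inter>i. (E i \<inter> H i) \<union> (- E i \<inter> H i))"
proof (intro equalityI subsetI)
  fix q :: "real ^ 'n nonempty"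
  assume "q \<in> range binary_point"
  then obtain A where q: "q = binary_point A" by blast
  obtain w where w: "w \<in> constituent E H A"
    using constituent_nonempty[OF assms] by blast
  then have "q = (\<chi> S. conjunction E H x S w)"
    using q by (simp add: conjunction_on_constituent)
  moreover have "w \<in> (\<Inter>i. (E i \<inter> H i) \<union> (- E i \<inter> H i))"
    using w by (auto simp: constituent_def)
  ultimately show "q \<in> (\<lambda>w. \<chi> S. conjunction E H x S w) ` (\<Inter>i. (E i \<inter> H i) \<union> (- E i \<inter> H i))"
    by blast
next
  fix q :: "real ^ 'n nonempty"
  assume "q \<in> (\<lambda>w. \<chi> S. conjunction E H x S w) ` (\<Inter>i. (E i \<inter> H i) \<union> (- E i \<inter> H i))"
  then obtain w where w: "w \<in> (\<Inter>i. (E i \<inter> H i) \<union> (- E i \<inter> H i))"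
    and q: "q = (\<chi> S. conjunction E H x S w)" by blast
  from w have "w \<in> constituent E H {i. w \<in> E i}"
    by (auto simp: constituent_def)
  then have "q = binary_point {i. w \<in> E i}"
    using q by (simp only: conjunction_on_constituent)
  then show "q \<in> range binary_point"
    by simp
qed

end

theory Submission imports Defs begin

text \<open>
  Write \<open>conj_vec E H w y\<close> for the value at \<open>w\<close> of the vector of all conjunctions, computed with the
  previsions \<open>y\<close>.  A conjunction takes the value of its own prevision when it is void, so every gain
  is an inner product \<open>a \<bullet> (conj_vec E H w x - x)\<close> (\<open>gain_eq_inner\<close>), and coherence says that on the
  disjunction of the conditioning events of the bet this is neither everywhere positive nor
  everywhere negative.

  If \<open>x\<close> lies in the convex hull of the binary points, no linear functional \<open>a \<bullet> _\<close> can exceed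
  \<open>a \<bullet> x\<close> at all of them, nor fall short of it at all of them.  Each binary point is the value of the vector of
  conjunctions at some \<open>w\<close> where nothing is void, and such a \<open>w\<close> belongs to every conditioning event;
  so coherence follows.

  Conversely, separating \<open>x\<close> from the hull by a hyperplane gives a bet that wins wherever
  nothing is void, but the outcomes where some, not all, of the conditional events are void
  must be handled too.  Two observations do this.  For fixed \<open>w\<close> the map \<open>conj_vec E H w\<close> is affine
  and sends binary points to binary points, because the previsions \<open>binary_point D\<close> act as if each
  void event with index in \<open>D\<close> were true and each other void event were false; hence it maps the
  hull into itself (\<open>conj_vec_in_hull\<close>).  Moreover it reads only the previsions of conjunctions of void events.
  So one proves by induction on a set \<open>U\<close> of indices that \<open>x\<close> agrees, in the coordinates
  \<open>S \<subseteq> U\<close>, with some point of the hull: when some \<open>H i\<close> with \<open>i \<in> U\<close> is true, the void indices in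
  \<open>U\<close> form a proper subset of \<open>U\<close>, the induction hypothesis lets \<open>x\<close> be replaced by a point of the
  hull, and the vector of conjunctions in the coordinates \<open>S \<subseteq> U\<close> is therefore in the projected hull.
  A hyperplane that separates the projection of \<open>x\<close> from the projected hull would thus give a bet on
  the conjunctions of events in \<open>U\<close> that wins on its whole conditioning event.
\<close>

section \<open>Gains as inner products\<close>

definition conj_vec :: "('n::finite \<Rightarrow> 'w set) \<Rightarrow> ('n \<Rightarrow> 'w set) \<Rightarrow> 'w \<Rightarrow>
    real ^ 'n nonempty \<Rightarrow> real ^ 'n nonempty" where
  "conj_vec E H w y = (\<chi> S. conjunction E H y S w)"

lemma gain_eq_inner:
  "gain J s (conj_rq E H x) (conj_event H) (\<lambda>S. x $ S) w =
    (\<chi> S. if S \<in> J then s S else 0) \<bullet> (conj_vec E H w x - x)"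
proof -
  have "s S * indicator (conj_event H S) w * (conj_rq E H x S w - x $ S) =
      s S * (conjunction E H x S w - x $ S)" for S
    by (simp add: conjunction_def cond_rq_def indicator_def)
  then have "gain J s (conj_rq E H x) (conj_event H) (\<lambda>S. x $ S) w =
      (\<Sum>S\<in>J. s S * (conjunction E H x S w - x $ S))"
    unfolding gain_def by (intro sum.cong refl)
  also have "\<dots> = (\<Sum>S\<in>UNIV. if S \<in> J then s S * (conjunction E H x S w - x $ S) else 0)"
    by (simp add: sum.If_cases)
  also have "\<dots> = (\<chi> S. if S \<in> J then s S else 0) \<bullet> (conj_vec E H w x - x)"
    unfolding inner_vec_def conj_vec_def by (intro sum.cong) auto
  finally show ?thesis .
qed

text \<open>Only finitely many gains occur, so the extrema in the definition of coherence are attained.\<close>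

lemma coherent_conjunctions_iff:
  fixes E H :: "'n::finite \<Rightarrow> 'w set" and x :: "real ^ 'n nonempty"
  assumes "logically_independent (case_sum E H)"
  shows "coherent_conjunctions E H x \<longleftrightarrow>
    (\<forall>J s. J \<noteq> {} \<longrightarrow>
      (\<exists>w\<in>\<Union>S\<in>J. conj_event H S. (\<chi> S. if S \<in> J then s S else 0) \<bullet> (conj_vec E H w x - x) \<le> 0) \<and>
      (\<exists>w\<in>\<Union>S\<in>J. conj_event H S. 0 \<le> (\<chi> S. if S \<in> J then s S else 0) \<bullet> (conj_vec E H w x - x)))"
proof -
  let ?g = "\<lambda>J s. gain J s (conj_rq E H x) (conj_event H) (\<lambda>S. x $ S)"
  let ?U = "\<lambda>J. \<Union>S\<in>J. conj_event H S"
  have "(Min (?g J s ` ?U J) \<le> 0 \<and> 0 \<le> Max (?g J s ` ?U J)) \<longleftrightarrow>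
      (\<exists>w\<in>?U J. ?g J s w \<le> 0) \<and> (\<exists>w\<in>?U J. 0 \<le> ?g J s w)" if "J \<noteq> {}" for J s
  proof -
    have fin: "finite (?g J s ` ?U J)"
      by (intro finite_gain_image finite_conj_rq_image) simp
    have ne: "?g J s ` ?U J \<noteq> {}"
      using that conj_event_nonempty[OF assms] by auto
    show ?thesis
      unfolding Min_le_iff[OF fin ne] Max_ge_iff[OF fin ne] by blast
  qed
  then show ?thesis
    unfolding coherent_conjunctions_def coherent_def gain_eq_inner by simp
qed

section \<open>Prevision points in the hull are coherent\<close>

lemma inner_le_some_vertex:
  fixes x :: "'a::real_inner"
  assumes "x \<in> convex hull (range q)"
  shows "\<exists>A. a \<bullet> q A \<le> a \<bullet> x"
proof (rule ccontr)
  assume "\<not> ?thesis"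
  then have "range q \<subseteq> {y. a \<bullet> y > a \<bullet> x}"
    by (auto simp: not_le)
  then have "convex hull (range q) \<subseteq> {y. a \<bullet> y > a \<bullet> x}"
    by (intro hull_minimal convex_halfspace_gt)
  with assms show False
    by blast
qed

lemma hull_imp_coherent:
  fixes E H :: "'n::finite \<Rightarrow> 'w set" and x :: "real ^ 'n nonempty"
  assumes indep: "logically_independent (case_sum E H)"
    and x: "x \<in> convex hull (range binary_point)"
  shows "coherent_conjunctions E H x"
proof -
  have attained: "\<exists>w\<in>\<Union>S\<in>J. conj_event H S. conj_vec E H w x = binary_point A"
    if "J \<noteq> {}" for J :: "'n nonempty set" and A
  proof -
    obtain w where w: "w \<in> constituent E H A"
      using constituent_nonempty[OF indep] by blast
    obtain S where "S \<in> J"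
      using \<open>J \<noteq> {}\<close> by blast
    moreover obtain i where "i \<in> elems S"
      using elems_nonempty[of S] by blast
    moreover have "w \<in> H i"
      using w by (cases "i \<in> A") (auto simp: constituent_def)
    ultimately have "w \<in> (\<Union>S\<in>J. conj_event H S)"
      by (auto simp: conj_event_def)
    moreover have "conj_vec E H w x = binary_point A"
      using conjunction_on_constituent[OF w] by (simp add: conj_vec_def)
    ultimately show ?thesis
      by blast
  qed
  have le: "\<exists>w\<in>\<Union>S\<in>J. conj_event H S. a \<bullet> (conj_vec E H w x - x) \<le> 0"
    if J: "J \<noteq> {}" for J :: "'n nonempty set" and a
  proof -
    obtain A where "a \<bullet> binary_point A \<le> a \<bullet> x"
      using inner_le_some_vertex[OF x] by blast
    moreover obtain w where "w \<in> (\<Union>S\<in>J. conj_event H S)" "conj_vec E H w x = binary_point A"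
      using attained[OF J, of A] by blast
    ultimately show ?thesis
      by (intro bexI[of _ w]) (simp_all add: inner_diff_right)
  qed
  have ge: "\<exists>w\<in>\<Union>S\<in>J. conj_event H S. 0 \<le> a \<bullet> (conj_vec E H w x - x)"
    if "J \<noteq> {}" for J :: "'n nonempty set" and a
    using le[OF that, of "- a"] by simp
  show ?thesis
    unfolding coherent_conjunctions_iff[OF indep] using le ge by blast
qed

section \<open>The vector of conjunctions as a self-map of the hull\<close>

lemma elems_Abs_nonempty: "S \<noteq> {} \<Longrightarrow> elems (Abs_nonempty S) = S"
  by (simp add: Abs_nonempty_inverse)

text \<open>
  The four cases of a conjunction, in a form that shows the dependence on the previsions: at most
  one of them is read, the one of the conjunction of the void members.
\<close>

lemma conj_vec_nth:
  "conj_vec E H w y $ S =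
    (if \<exists>i\<in>elems S. w \<in> - E i \<inter> H i then 0
     else if elems S \<inter> {i. w \<notin> H i} = {} then 1
     else y $ Abs_nonempty (elems S \<inter> {i. w \<notin> H i}))"
proof -
  let ?V = "elems S \<inter> {i. w \<notin> H i}"
  consider (false) i where "i \<in> elems S" "w \<in> - E i \<inter> H i"
    | (true) "\<forall>i\<in>elems S. w \<in> E i \<inter> H i"
    | (void) "\<forall>i\<in>elems S. w \<notin> H i"
    | (partly) "\<forall>i\<in>elems S. w \<notin> - E i \<inter> H i" "?V \<noteq> {}" "?V \<subset> elems S"
    by blast
  then show ?thesis
  proof cases
    case false
    then show ?thesis
      using conjunction_false[of i S w E H y] by (auto simp: conj_vec_def)
  next
    case true
    then have "conjunction E H y S w = 1"
      by (intro conjunction_true) blast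
    moreover have "\<not> (\<exists>i\<in>elems S. w \<in> - E i \<inter> H i)" "?V = {}"
      using true by blast+
    ultimately show ?thesis
      by (simp only: conj_vec_def vec_lambda_beta if_False if_True refl)
  next
    case void
    then have "conjunction E H y S w = y $ S"
      by (intro conjunction_void) blast
    moreover have "\<not> (\<exists>i\<in>elems S. w \<in> - E i \<inter> H i)" "?V = elems S"
      using void by blast+
    ultimately show ?thesis
      by (simp only: conj_vec_def vec_lambda_beta if_False elems_nonempty elems_inverse)
  next
    case partly
    have "conjunction E H y S w = y $ Abs_nonempty ?V"
      using partly(1,3)
      by (intro conjunction_partly_void; unfold elems_Abs_nonempty[OF partly(2)]) blast+
    moreover have "\<not> (\<exists>i\<in>elems S. w \<in> - E i \<inter> H i)"
      using partly by blast
    ultimately show ?thesis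
      using partly by (simp only: conj_vec_def vec_lambda_beta if_False)
  qed
qed

text \<open>Each coordinate is a constant or a coordinate of \<open>y\<close>, and \<open>u + v = 1\<close> preserves constants.\<close>

lemma conj_vec_affine:
  assumes "u + v = 1"
  shows "conj_vec E H w (u *\<^sub>R y + v *\<^sub>R z) = u *\<^sub>R conj_vec E H w y + v *\<^sub>R conj_vec E H w z"
  using assms by (auto simp: vec_eq_iff conj_vec_nth)

lemma conj_vec_binary_point:
  "conj_vec E H w (binary_point D) =
    binary_point ({i. w \<in> E i \<inter> H i} \<union> (D \<inter> {i. w \<notin> H i}))"
  by (auto simp: vec_eq_iff conj_vec_nth binary_point_def elems_Abs_nonempty)

lemma conj_vec_in_hull:
  assumes "y \<in> convex hull (range binary_point)"
  shows "conj_vec E H w y \<in> convex hull (range binary_point)"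
proof -
  let ?K = "convex hull (range binary_point)"
  have "convex {y. conj_vec E H w y \<in> ?K}"
    by (rule convexI) (simp add: conj_vec_affine convexD[OF convex_convex_hull])
  moreover have "range binary_point \<subseteq> {y. conj_vec E H w y \<in> ?K}"
    by (auto simp: conj_vec_binary_point intro: hull_inc)
  ultimately have "?K \<subseteq> {y. conj_vec E H w y \<in> ?K}"
    by (simp add: hull_minimal)
  with assms show ?thesis
    by blast
qed

section \<open>Coherent prevision points lie in the hull\<close>

definition restrict_coords :: "'n::finite set \<Rightarrow> real ^ 'n nonempty \<Rightarrow> real ^ 'n nonempty" where
  "restrict_coords U y = (\<chi> S. if elems S \<subseteq> U then y $ S else 0)"

lemma linear_restrict_coords: "linear (restrict_coords U)"
  by (rule linearI) (auto simp: restrict_coords_def vec_eq_iff)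

lemma inner_restrict_coords: "restrict_coords U a \<bullet> y = a \<bullet> restrict_coords U y"
  unfolding inner_vec_def restrict_coords_def by (intro sum.cong) auto

text \<open>
  The conjunctions within \<open>U\<close> see \<open>y\<close> only through the conjunctions of void members of \<open>U\<close>.
  When some event of \<open>U\<close> is not void, this reduces a statement about \<open>U\<close> to one about a proper
  subset of \<open>U\<close>.
\<close>

lemma restrict_conj_vec_cong:
  assumes "restrict_coords (U \<inter> {i. w \<notin> H i}) y = restrict_coords (U \<inter> {i. w \<notin> H i}) z"
  shows "restrict_coords U (conj_vec E H w y) = restrict_coords U (conj_vec E H w z)"
proof -
  have agree: "y $ Abs_nonempty T = z $ Abs_nonempty T"
    if "T \<noteq> {}" "T \<subseteq> U \<inter> {i. w \<notin> H i}" for T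
    using arg_cong[OF assms, of "\<lambda>v. v $ Abs_nonempty T"] that
    by (simp add: restrict_coords_def elems_Abs_nonempty)
  have "conj_vec E H w y $ S = conj_vec E H w z $ S" if "elems S \<subseteq> U" for S
  proof (cases "elems S \<inter> {i. w \<notin> H i} = {}")
    case False
    then have "y $ Abs_nonempty (elems S \<inter> {i. w \<notin> H i}) = z $ Abs_nonempty (elems S \<inter> {i. w \<notin> H i})"
      using that by (intro agree) auto
    then show ?thesis
      by (simp only: conj_vec_nth)
  qed (simp add: conj_vec_nth)
  then show ?thesis
    by (simp add: restrict_coords_def vec_eq_iff)
qed

text \<open>
  The statement for \<open>U = UNIV\<close> alone would not support an induction: a bet on the whole family is
  evaluated also where some events are void, and there its gain depends on the previsions of the
  conjunctions of those events.  That these are in the projected hull comes from betting on them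
  alone, a bet that is called off exactly when all of them are void.
\<close>

lemma coherent_imp_restriction_in_hull:
  fixes E H :: "'n::finite \<Rightarrow> 'w set" and x :: "real ^ 'n nonempty"
  assumes indep: "logically_independent (case_sum E H)"
    and coh: "coherent_conjunctions E H x"
  shows "restrict_coords U x \<in> restrict_coords U ` (convex hull (range binary_point))"
    (is "_ \<in> _ ` ?K")
proof (induction U rule: finite_psubset_induct[OF finite])
  case (1 U)
  let ?r = "restrict_coords U"
  show ?case
  proof (rule ccontr)
    assume out: "?r x \<notin> ?r ` ?K"
    \<comment> \<open>Coherence is about nonempty families, so \<open>U = {}\<close> needs its own argument.\<close>
    have "U \<noteq> {}"
    proof
      assume "U = {}"
      then have "?r x = ?r (binary_point {})"
        by (simp add: restrict_coords_def)
      with out show False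
        by (auto intro: hull_inc)
    qed
    have "compact ?K"
      by (intro finite_imp_compact_convex_hull) simp
    then have "closed (?r ` ?K)"
      by (intro compact_imp_closed compact_continuous_image linear_continuous_on)
        (simp_all add: linear_restrict_coords linear_conv_bounded_linear[symmetric])
    moreover have "convex (?r ` ?K)"
      by (intro convex_linear_image linear_restrict_coords convex_convex_hull)
    ultimately obtain a b where sep: "a \<bullet> ?r x < b" "\<And>y. y \<in> ?r ` ?K \<Longrightarrow> b < a \<bullet> y"
      using separating_hyperplane_closed_point[OF _ _ out] by metis
    \<comment> \<open>The separating functional, read as stakes on the conjunctions within \<open>U\<close>.\<close>
    define J where "J = {S. elems S \<subseteq> U}"
    have "Abs_nonempty U \<in> J"
      using \<open>U \<noteq> {}\<close> by (simp add: J_def elems_Abs_nonempty)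
    then obtain w where w: "w \<in> (\<Union>S\<in>J. conj_event H S)"
      and loss: "(\<chi> S. if S \<in> J then a $ S else 0) \<bullet> (conj_vec E H w x - x) \<le> 0"
      using coh unfolding coherent_conjunctions_iff[OF indep] by blast
    have "a \<bullet> ?r (conj_vec E H w x) \<le> a \<bullet> ?r x"
      using loss by (simp add: J_def restrict_coords_def[symmetric] inner_diff_right inner_restrict_coords)
    moreover have "?r (conj_vec E H w x) \<in> ?r ` ?K"
    proof -
      let ?V = "U \<inter> {i. w \<notin> H i}"
      have "?V \<subset> U"
        using w by (auto simp: J_def conj_event_def)
      then obtain y where "y \<in> ?K" "restrict_coords ?V x = restrict_coords ?V y"
        using "1.IH" by blast
      then show ?thesis
        using restrict_conj_vec_cong[of U w H x y E] conj_vec_in_hull[of y E H w] by simp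
    qed
    ultimately show False
      using sep by fastforce
  qed
qed

theorem theorem15:
  fixes E H :: "'n::finite \<Rightarrow> 'w set" and x :: "real ^ 'n nonempty"
  assumes "logically_independent (case_sum E H)"
  shows "coherent_conjunctions E H x \<longleftrightarrow> x \<in> convex hull (range binary_point)"
proof
  assume "coherent_conjunctions E H x"
  then have "restrict_coords UNIV x \<in> restrict_coords UNIV ` (convex hull (range binary_point))"
    by (rule coherent_imp_restriction_in_hull[OF assms])
  moreover have "restrict_coords UNIV y = y" for y :: "real ^ 'n nonempty"
    by (simp add: restrict_coords_def vec_eq_iff)
  ultimately show "x \<in> convex hull (range binary_point)"
    by simp
next
  assume "x \<in> convex hull (range binary_point)"
  then show "coherent_conjunctions E H x"
    by (rule hull_imp_coherent[OF assms])
qed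

end
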